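(* Let $X$ be a set with a $\sigma$-algebra $\Sigma$ and a finitely additive measure $\mu$ on $\Sigma$. Let $S\in\Sigma$ and let $f,g:X\to\mathbb{R}$ be non-negative measurable functions that vanish outside $S$ and satisfy $f+g\ge\mathbf{1}_S$. Then \[\int f\,d\mu+\int g\,d\mu\ge\mu(S).\]
   Context: A simple function is $s=\sum_{i=1}^n c_i\mathbf{1}_{S_i}$ with $n<\infty$, $c_i\in\mathbb{R}$, $S_i\in\Sigma$, and $\int s\,d\mu=\sum_{i=1}^n c_i\mu(S_i)$. For measurable $f:X\to\mathbb{R}$, $\int f\,d\mu=\sup\{\int s\,d\mu: s\text{ simple},\ s\le f\}$. Finite additivity means $\mu(\bigcup_{i=1}^n A_i)=\sum_{i=1}^n\mu(A_i)$ for disjoint $A_1,\dots,A_n\in\Sigma$ (countable additivity is not assumed). *)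

theory Defs
  imports "HOL-Analysis.Analysis"
begin

text \<open>
  A finitely additive measure takes values in the extended half-line \<open>[0, \<infinity>]\<close>; finite measures
  are the special case in which \<open>\<infinity>\<close> is not attained. The case \<open>n = 0\<close> of finite additivity is
  \<open>\<mu> {} = 0\<close>.
\<close>

locale finitely_additive_measure = sigma_algebra \<Omega> M
  for \<Omega> :: "'a set" and M :: "'a set set" +
  fixes \<mu> :: "'a set \<Rightarrow> ennreal"
  assumes finite_additivity:
    "\<And>(n::nat) A. (\<And>i. i < n \<Longrightarrow> A i \<in> M) \<Longrightarrow> disjoint_family_on A {..<n} \<Longrightarrow>
       \<mu> (\<Union>i<n. A i) = (\<Sum>i<n. \<mu> (A i))"

text \<open>
  \<open>has_simple_integral \<Omega> M \<mu> s I\<close>: on \<open>\<Omega>\<close>, \<open>s\<close> is a finite real combination of indicators of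
  sets in \<open>M\<close>, and \<open>I\<close> is the corresponding combination of their measures (with \<open>0 * \<infinity> = 0\<close>).
  The penultimate condition excludes only representations whose combination would contain
  \<open>\<infinity> - \<infinity>\<close>, which has no meaning (but is \<open>\<infinity>\<close> in type \<open>ereal\<close>); it is vacuous when \<open>\<mu>\<close> is finite.
\<close>

definition has_simple_integral ::
    "'a set \<Rightarrow> 'a set set \<Rightarrow> ('a set \<Rightarrow> ennreal) \<Rightarrow> ('a \<Rightarrow> real) \<Rightarrow> ereal \<Rightarrow> bool" where
  "has_simple_integral \<Omega> M \<mu> s I \<longleftrightarrow>
     (\<exists>(n::nat) (c :: nat \<Rightarrow> real) (A :: nat \<Rightarrow> 'a set).
        (\<forall>i<n. A i \<in> M) \<and>
        (\<forall>x\<in>\<Omega>. s x = (\<Sum>i<n. c i * indicator (A i) x)) \<and>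
        \<not> ((\<exists>i<n. 0 < c i \<and> \<mu> (A i) = \<infinity>) \<and> (\<exists>j<n. c j < 0 \<and> \<mu> (A j) = \<infinity>)) \<and>
        I = (\<Sum>i<n. ereal (c i) * enn2ereal (\<mu> (A i))))"

definition fa_integral ::
    "'a set \<Rightarrow> 'a set set \<Rightarrow> ('a set \<Rightarrow> ennreal) \<Rightarrow> ('a \<Rightarrow> real) \<Rightarrow> ereal" where
  "fa_integral \<Omega> M \<mu> f =
     Sup {I. \<exists>s. has_simple_integral \<Omega> M \<mu> s I \<and> (\<forall>x\<in>\<Omega>. s x \<le> f x)}"

end

theory Submission
  imports Defs "HOL-Real_Asymp.Real_Asymp"
begin

text \<open>
  Cut \<open>S\<close> into the level sets of \<open>min N \<lfloor>N f\<rfloor>\<close>. On level \<open>k\<close> we have \<open>f \<ge> k / N\<close> and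
  \<open>g \<ge> (N - 1 - k) / N\<close>, and these two step functions have integrals adding up to at least
  \<open>(1 - 1 / N) \<mu>(S)\<close>. All coefficients are non-negative, so no \<open>\<infinity> - \<infinity>\<close> arises, and
  \<open>N \<rightarrow> \<infinity>\<close> gives the claim even when \<open>\<mu>(S) = \<infinity>\<close>.
\<close>

text \<open>The combination is itself a simple function below \<open>f\<close>, hence a member of
  the set under the supremum. The sign condition on \<open>c\<close> discharges the exclusion of
  opposite infinities.\<close>

lemma fa_integral_ge_nonneg_combination:
  fixes n :: nat
  assumes "\<And>i. i < n \<Longrightarrow> A i \<in> M" and "\<And>i. i < n \<Longrightarrow> 0 \<le> c i"
    and "\<And>x. x \<in> \<Omega> \<Longrightarrow> (\<Sum>i<n. c i * indicator (A i) x) \<le> f x"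
  shows "(\<Sum>i<n. ereal (c i) * enn2ereal (\<mu> (A i))) \<le> fa_integral \<Omega> M \<mu> f"
proof -
  have "has_simple_integral \<Omega> M \<mu> (\<lambda>x. \<Sum>i<n. c i * indicator (A i) x)
      (\<Sum>i<n. ereal (c i) * enn2ereal (\<mu> (A i)))"
    unfolding has_simple_integral_def
    using assms(1,2) by (intro exI[of _ n] exI[of _ c] exI[of _ A]) (auto simp: not_less[symmetric])
  then show ?thesis
    unfolding fa_integral_def using assms(3) by (intro Sup_upper) auto
qed

text \<open>The level sets of \<phi> are disjoint, so at most the term \<open>k = \<phi> x\<close>
  survives.\<close>

lemma sum_mult_indicator_level_sets:
  fixes c :: "nat \<Rightarrow> real"
  assumes "x \<in> S \<Longrightarrow> \<phi> x < n"
  shows "(\<Sum>k<n. c k * indicator {y \<in> S. \<phi> y = k} x) = (if x \<in> S then c (\<phi> x) else 0)"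
proof (cases "x \<in> S")
  case True
  then have "(\<Sum>k<n. c k * indicator {y \<in> S. \<phi> y = k} x) = (\<Sum>k<n. if k = \<phi> x then c k else 0)"
    by (intro sum.cong) (auto simp: indicator_def)
  then show ?thesis using assms True by simp
qed simp

text \<open>The factor tends to 1, which is neither 0 nor infinite, so multiplication on
  \<open>ereal\<close> is continuous there even for \<open>a = \<infinity>\<close>.\<close>

lemma ereal_le_if_shrunk_le:
  fixes a b :: ereal
  assumes "0 \<le> a" and le: "\<And>N::nat. 2 \<le> N \<Longrightarrow> ereal (real (N - 1) / real N) * a \<le> b"
  shows "a \<le> b"
proof (rule tendsto_upperbound)
  have "(\<lambda>N. real (N - 1) / real N) \<longlonglongrightarrow> 1"
    by real_asymp
  then have "(\<lambda>N. ereal (real (N - 1) / real N) * a) \<longlonglongrightarrow> ereal 1 * a"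
    by (intro tendsto_mult_ereal tendsto_const) auto
  then show "(\<lambda>N. ereal (real (N - 1) / real N) * a) \<longlonglongrightarrow> a"
    by (simp flip: one_ereal_def)
  show "\<forall>\<^sub>F N in sequentially. ereal (real (N - 1) / real N) * a \<le> b"
    using le by (rule eventually_sequentiallyI)
qed simp

text \<open>Both step functions live on the same partition of \<open>S\<close>, so their sums can be
  compared with that of \<open>\<mu> S\<close> level by level.\<close>

lemma fa_integral_add_ge_shrunk:
  fixes N :: nat
  assumes "finitely_additive_measure \<Omega> M \<mu>"
    and "S \<in> M"
    and f: "f \<in> borel_measurable (sigma \<Omega> M)"
    and f0: "\<forall>x\<in>\<Omega>. 0 \<le> f x" and g0: "\<forall>x\<in>\<Omega>. 0 \<le> g x"
    and fg: "\<forall>x\<in>S. 1 \<le> f x + g x"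
    and "0 < N"
  shows "ereal (real (N - 1) / real N) * enn2ereal (\<mu> S)
    \<le> fa_integral \<Omega> M \<mu> f + fa_integral \<Omega> M \<mu> g"
proof -
  interpret finitely_additive_measure \<Omega> M \<mu> by fact
  \<comment> \<open>The cap \<open>N\<close> leaves only finitely many levels, namely 0 to
    \<open>N\<close>, even if \<open>f\<close> is unbounded.\<close>
  define \<phi> where "\<phi> = (\<lambda>x. min N (nat \<lfloor>real N * f x\<rfloor>))"
  define A where "A = (\<lambda>k. {x \<in> S. \<phi> x = k})"
  define m where "m = (\<lambda>k. enn2ereal (\<mu> (A k)))"
  have S: "S \<subseteq> \<Omega>" using \<open>S \<in> M\<close> sets_into_space by auto
  have \<phi>_less: "\<phi> x < Suc N" for x by (simp add: \<phi>_def)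
  have [measurable]: "S \<in> sets (sigma \<Omega> M)" "f \<in> borel_measurable (sigma \<Omega> M)"
    using \<open>S \<in> M\<close> f by (simp_all add: sets_measure_of_eq)
  have A: "A k \<in> M" for k
  proof -
    have "{x \<in> space (sigma \<Omega> M). x \<in> S \<and> \<phi> x = k} \<in> sets (sigma \<Omega> M)"
      unfolding \<phi>_def by measurable
    moreover have "{x \<in> space (sigma \<Omega> M). x \<in> S \<and> \<phi> x = k} = A k"
      using S by (auto simp: A_def space_measure_of_conv)
    ultimately show ?thesis by (simp add: sets_measure_of_eq)
  qed
  have m0: "0 \<le> m k" for k by (simp add: m_def)

  have "(\<Union>k<Suc N. A k) = S" using \<phi>_less by (auto simp: A_def)
  moreover have "disjoint_family_on A {..<Suc N}"
    by (auto simp: disjoint_family_on_def A_def)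
  ultimately have "\<mu> S = (\<Sum>k<Suc N. \<mu> (A k))"
    using finite_additivity[of "Suc N" A] A by simp
  then have \<mu>S: "enn2ereal (\<mu> S) = (\<Sum>k<Suc N. m k)"
    by (simp add: m_def del: sum.lessThan_Suc)

  have "ereal (real (N - 1) / real N) * enn2ereal (\<mu> S)
      = (\<Sum>k<Suc N. ereal (real (N - 1) / real N) * m k)"
    unfolding \<mu>S using m0 by (intro sum_ereal_right_distrib) auto
  also have "\<dots> \<le> (\<Sum>k<Suc N. ereal (real k / real N) * m k + ereal (real (N - 1 - k) / real N) * m k)"
  proof (intro sum_mono)
    fix k
    \<comment> \<open>Subtraction on \<open>nat\<close> truncates: equality holds for
      \<open>k \<le> N - 1\<close>, while at the top level \<open>k = N\<close> the second term is 0
      and the first is 1.\<close>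
    have "real (N - 1) / real N \<le> real k / real N + real (N - 1 - k) / real N"
      by (simp add: divide_right_mono flip: add_divide_distrib of_nat_add)
    then have "ereal (real (N - 1) / real N) * m k
        \<le> (ereal (real k / real N) + ereal (real (N - 1 - k) / real N)) * m k"
      using m0 by (intro ereal_mult_right_mono) auto
    then show "ereal (real (N - 1) / real N) * m k
        \<le> ereal (real k / real N) * m k + ereal (real (N - 1 - k) / real N) * m k"
      \<comment> \<open>Both scalars are non-negative, so distributivity holds even for infinite
        \<open>m k\<close>.\<close>
      by (subst (asm) ereal_left_distrib) auto
  qed
  also have "\<dots> = (\<Sum>k<Suc N. ereal (real k / real N) * m k)
      + (\<Sum>k<Suc N. ereal (real (N - 1 - k) / real N) * m k)"
    by (rule sum.distrib)
  also have "\<dots> \<le> fa_integral \<Omega> M \<mu> f + fa_integral \<Omega> M \<mu> g"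
    unfolding m_def
  proof (intro add_mono fa_integral_ge_nonneg_combination A)
    fix x assume "x \<in> \<Omega>"
    have f_ge: "real (\<phi> x) / real N \<le> f x"
    proof -
      have "real (\<phi> x) \<le> real (nat \<lfloor>real N * f x\<rfloor>)" by (simp add: \<phi>_def)
      also have "\<dots> \<le> real N * f x" using f0 \<open>x \<in> \<Omega>\<close> by simp
      finally show ?thesis using \<open>0 < N\<close> by (simp add: field_simps)
    qed
    \<comment> \<open>Below level \<open>N - 1\<close> the cap is inactive, so
      \<open>N * f x < \<phi> x + 1\<close>, and \<open>f + g \<ge> 1\<close> forces
      \<open>N * g x > N - 1 - \<phi> x\<close>. From level \<open>N - 1\<close> on the truncated
      difference is 0.\<close>
    have g_ge: "real (N - 1 - \<phi> x) / real N \<le> g x" if "x \<in> S"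
    proof (cases "\<phi> x < N - 1")
      case True
      then have "\<phi> x = nat \<lfloor>real N * f x\<rfloor>" by (auto simp: \<phi>_def min_def split: if_splits)
      then have "real N * f x < real (\<phi> x) + 1" by linarith
      moreover have "real N \<le> real N * f x + real N * g x"
        using fg that \<open>0 < N\<close> by (simp flip: distrib_left)
      ultimately have "real (N - 1 - \<phi> x) \<le> real N * g x" using True by (simp add: of_nat_diff)
      then show ?thesis using \<open>0 < N\<close> by (simp add: field_simps)
    next
      case False
      then show ?thesis using g0 \<open>x \<in> \<Omega>\<close> by simp
    qed
    \<comment> \<open>Outside \<open>S\<close> the step functions vanish, so there
      \<open>f \<ge> 0\<close> and \<open>g \<ge> 0\<close> are enough.\<close>
    show "(\<Sum>k<Suc N. real k / real N * indicator (A k) x) \<le> f x"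
      unfolding A_def using f_ge f0 \<open>x \<in> \<Omega>\<close>
      by (subst sum_mult_indicator_level_sets) (auto simp: \<phi>_less)
    show "(\<Sum>k<Suc N. real (N - 1 - k) / real N * indicator (A k) x) \<le> g x"
      unfolding A_def using g_ge g0 \<open>x \<in> \<Omega>\<close>
      by (subst sum_mult_indicator_level_sets) (auto simp: \<phi>_less)
  qed simp_all
  finally show ?thesis .
qed

theorem theoremA3:
  fixes \<Omega> :: "'a set" and M :: "'a set set" and \<mu> :: "'a set \<Rightarrow> ennreal"
    and S :: "'a set" and f g :: "'a \<Rightarrow> real"
  assumes "finitely_additive_measure \<Omega> M \<mu>"
    and "S \<in> M"
    and "f \<in> borel_measurable (sigma \<Omega> M)" and "g \<in> borel_measurable (sigma \<Omega> M)"
    and "\<forall>x\<in>\<Omega>. 0 \<le> f x" and "\<forall>x\<in>\<Omega>. 0 \<le> g x"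
    and "\<forall>x\<in>\<Omega> - S. f x = 0" and "\<forall>x\<in>\<Omega> - S. g x = 0"
    and "\<forall>x\<in>\<Omega>. indicator S x \<le> f x + g x"
  shows "fa_integral \<Omega> M \<mu> f + fa_integral \<Omega> M \<mu> g \<ge> enn2ereal (\<mu> S)"
proof (rule ereal_le_if_shrunk_le)
  interpret finitely_additive_measure \<Omega> M \<mu> by fact
  have "\<forall>x\<in>S. 1 \<le> f x + g x"
  proof
    fix x assume "x \<in> S"
    then have "x \<in> \<Omega>" using \<open>S \<in> M\<close> sets_into_space by auto
    then show "1 \<le> f x + g x" using assms(9) \<open>x \<in> S\<close> by (metis indicator_simps(1))
  qed
  then show "ereal (real (N - 1) / real N) * enn2ereal (\<mu> S)
      \<le> fa_integral \<Omega> M \<mu> f + fa_integral \<Omega> M \<mu> g" if "2 \<le> N" for N :: nat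
    using assms that by (intro fa_integral_add_ge_shrunk) auto
qed simp

end
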